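(* Let $a,b,c\in\mathbb{R}$. (i) On $\mathfrak{gl}(2,\mathbb{R})$, let $\psi=ax_1+by_1+cz_1$, $\omega_{1,\psi}=\psi\wedge t+d\psi$ and $\langle U,V\rangle_{1,\psi}=\omega_{1,\psi}(J_1U,V)$. Then $\langle\cdot,\cdot\rangle_{1,\psi}$ defines, together with $J_1$, a (positive definite) lcK metric on $\mathfrak{gl}(2,\mathbb{R})$ if and only if $c>0$ and $c^2>a^2+b^2$. It is of Vaisman type if and only if $c>0$ and $a=b=0$; and it is of non-Vaisman type (that is, lcK but not Vaisman) if and only if $c>0$ and $c^2>a^2+b^2>0$. (ii) On $\mathfrak u(2)$, let $\psi=ax_2+by_2+cz_2$, $\omega_{2,\psi}=\psi\wedge t+d\psi$ and $\langle U,V\rangle_{2,\psi}=\omega_{2,\psi}(J_2U,V)$. Then $\langle\cdot,\cdot\rangle_{2,\psi}$ defines, together with $J_2$, a (positive definite) lcK metric on $\mathfrak u(2)$ if and only if $c>0$ and $a=b=0$; and thus it is always of Vaisman type.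
   Context: $\mathfrak{gl}(2,\mathbb{R})=\mathbb{R}\oplus\mathfrak{sl}(2,\mathbb{R})$ has a basis $\{T,X_1,Y_1,Z_1\}$ with $T$ central and $[X_1,Y_1]=Z_1$, $[Z_1,X_1]=-Y_1$, $[Z_1,Y_1]=X_1$; let $t,x_1,y_1,z_1$ be the dual basis (Maurer–Cartan forms), so $dt=0$, $dx_1=y_1\wedge z_1$, $dy_1=z_1\wedge x_1$, $dz_1=y_1\wedge x_1$. The complex structure $J_1$ is $J_1X_1=Y_1$, $J_1Y_1=-X_1$, $J_1T=Z_1$, $J_1Z_1=-T$. $\mathfrak u(2)=\mathbb{R}\oplus\mathfrak{su}(2)$ has a basis $\{T,X_2,Y_2,Z_2\}$ with $T$ central and $[X_2,Y_2]=-Z_2$, $[Z_2,X_2]=-Y_2$, $[Z_2,Y_2]=X_2$; let $t,x_2,y_2,z_2$ be the dual basis, so $dt=0$, $dx_2=y_2\wedge z_2$, $dy_2=z_2\wedge x_2$, $dz_2=x_2\wedge y_2$. The complex structure $J_2$ is $J_2Y_2=X_2$, $J_2X_2=-Y_2$, $J_2T=Z_2$, $J_2Z_2=-T$. A Hermitian structure on a Lie algebra $\mathfrak g$ is a pair $(\langle\cdot,\cdot\rangle,J)$ of a scalar product and a skew-symmetric $J$ with $J^2=-\mathrm{Id}$ and vanishing Nijenhuis tensor; its fundamental form is $\omega=\langle\cdot,J\cdot\rangle$. It is locally conformally Kähler (lcK) if $d\omega=\omega\wedge\theta$ for a closed $1$-form $\theta\in\mathfrak g^*$ (the Lee form; $d$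 is the Chevalley–Eilenberg differential), and then it is called Vaisman if $\nabla\theta=0$, where $\nabla$ is the Levi-Civita connection. *)

theory Defs
  imports "HOL-Analysis.Analysis"
begin

text \<open>
  The elements of the Lie algebra are the elements of the type. A $k$-form is represented by the
  corresponding curried function of $k$ vectors. Wedge products follow the determinant convention
  (no factors $1/k!$), which is the one for which the Chevalley--Eilenberg differential
  $d\alpha(U,V) = -\alpha([U,V])$ gives $dx = y \wedge z$ when $[Y,Z] = -X$.
\<close>

definition wedge11 ::
  "('g \<Rightarrow> real) \<Rightarrow> ('g \<Rightarrow> real) \<Rightarrow> 'g \<Rightarrow> 'g \<Rightarrow> real" where
  "wedge11 \<alpha> \<beta> U V = \<alpha> U * \<beta> V - \<alpha> V * \<beta> U"

definition wedge21 ::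
  "('g \<Rightarrow> 'g \<Rightarrow> real) \<Rightarrow> ('g \<Rightarrow> real) \<Rightarrow> 'g \<Rightarrow> 'g \<Rightarrow> 'g \<Rightarrow> real" where
  "wedge21 \<omega> \<theta> U V W = \<omega> U V * \<theta> W + \<omega> V W * \<theta> U + \<omega> W U * \<theta> V"

definition scalar_product :: "('g::real_vector \<Rightarrow> 'g \<Rightarrow> real) \<Rightarrow> bool" where
  "scalar_product ip \<longleftrightarrow>
     bilinear ip \<and> (\<forall>U V. ip U V = ip V U) \<and> (\<forall>U. U \<noteq> 0 \<longrightarrow> 0 < ip U U)"

definition fundamental_form ::
  "('g \<Rightarrow> 'g \<Rightarrow> real) \<Rightarrow> ('g \<Rightarrow> 'g) \<Rightarrow> 'g \<Rightarrow> 'g \<Rightarrow> real" where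
  "fundamental_form ip J U V = ip U (J V)"

locale lie_algebra =
  fixes br :: "'g::real_vector \<Rightarrow> 'g \<Rightarrow> 'g"
  assumes bilinear_br: "bilinear br"
    and br_self: "br U U = 0"
    and jacobi: "br U (br V W) + br V (br W U) + br W (br U V) = 0"
begin

definition d1 :: "('g \<Rightarrow> real) \<Rightarrow> 'g \<Rightarrow> 'g \<Rightarrow> real" where
  "d1 \<alpha> U V = - \<alpha> (br U V)"

definition d2 :: "('g \<Rightarrow> 'g \<Rightarrow> real) \<Rightarrow> 'g \<Rightarrow> 'g \<Rightarrow> 'g \<Rightarrow> real" where
  "d2 \<omega> U V W = - \<omega> (br U V) W + \<omega> (br U W) V - \<omega> (br V W) U"

definition nijenhuis :: "('g \<Rightarrow> 'g) \<Rightarrow> 'g \<Rightarrow> 'g \<Rightarrow> 'g" where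
  "nijenhuis J U V = br (J U) (J V) - J (br (J U) V) - J (br U (J V)) - br U V"

definition hermitian :: "('g \<Rightarrow> 'g \<Rightarrow> real) \<Rightarrow> ('g \<Rightarrow> 'g) \<Rightarrow> bool" where
  "hermitian ip J \<longleftrightarrow>
     scalar_product ip \<and> linear J \<and> (\<forall>U V. ip (J U) V = - ip U (J V)) \<and>
     (\<forall>U. J (J U) = - U) \<and> (\<forall>U V. nijenhuis J U V = 0)"

definition lee_form ::
  "('g \<Rightarrow> 'g \<Rightarrow> real) \<Rightarrow> ('g \<Rightarrow> 'g) \<Rightarrow> ('g \<Rightarrow> real) \<Rightarrow> bool" where
  "lee_form ip J \<theta> \<longleftrightarrow>
     linear \<theta> \<and> (\<forall>U V. d1 \<theta> U V = 0) \<and>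
     (\<forall>U V W. d2 (fundamental_form ip J) U V W = wedge21 (fundamental_form ip J) \<theta> U V W)"

definition lcK :: "('g \<Rightarrow> 'g \<Rightarrow> real) \<Rightarrow> ('g \<Rightarrow> 'g) \<Rightarrow> bool" where
  "lcK ip J \<longleftrightarrow> hermitian ip J \<and> (\<exists>\<theta>. lee_form ip J \<theta>)"

text \<open>
  The Levi-Civita connection is the torsion-free metric one; functions of the form
  $\langle V, W \rangle$ with $V, W$ left-invariant are constant, so their derivatives do not
  appear.
\<close>

definition levi_civita ::
  "('g \<Rightarrow> 'g \<Rightarrow> real) \<Rightarrow> ('g \<Rightarrow> 'g \<Rightarrow> 'g) \<Rightarrow> bool" where
  "levi_civita ip nabla \<longleftrightarrow>
     bilinear nabla \<and>
     (\<forall>U V. nabla U V - nabla V U = br U V) \<and>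
     (\<forall>U V W. ip (nabla U V) W + ip V (nabla U W) = 0)"

definition covariant_derivative ::
  "('g \<Rightarrow> 'g \<Rightarrow> 'g) \<Rightarrow> ('g \<Rightarrow> real) \<Rightarrow> 'g \<Rightarrow> 'g \<Rightarrow> real" where
  "covariant_derivative nabla \<theta> U V = - \<theta> (nabla U V)"

definition vaisman :: "('g \<Rightarrow> 'g \<Rightarrow> real) \<Rightarrow> ('g \<Rightarrow> 'g) \<Rightarrow> bool" where
  "vaisman ip J \<longleftrightarrow>
     hermitian ip J \<and>
     (\<exists>\<theta> nabla. lee_form ip J \<theta> \<and> levi_civita ip nabla \<and>
        (\<forall>U V. covariant_derivative nabla \<theta> U V = 0))"

end

definition commutator :: "'a::ring_1 ^'n ^'n \<Rightarrow> 'a ^'n ^'n \<Rightarrow> 'a ^'n ^'n" where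
  "commutator A B = A ** B - B ** A"

lemma commutator_jacobi:
  fixes A B C :: "'a::ring_1 ^'n ^'n"
  shows "commutator A (commutator B C) + commutator B (commutator C A)
       + commutator C (commutator A B) = 0"
proof -
  have l: "X ** (Y - Z) = X ** Y - X ** Z" for X Y Z :: "'a ^'n ^'n"
    by (simp add: vec_eq_iff matrix_matrix_mult_def right_diff_distrib sum_subtractf)
  have r: "(Y - Z) ** X = Y ** X - Z ** X" for X Y Z :: "'a ^'n ^'n"
    by (simp add: vec_eq_iff matrix_matrix_mult_def left_diff_distrib sum_subtractf)
  show ?thesis
    by (simp add: commutator_def l r matrix_mul_assoc)
qed

lemma bilinear_commutator:
  "bilinear (commutator :: 'a::real_algebra_1 ^'n ^'n \<Rightarrow> _)"
  unfolding bilinear_def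
  by (auto intro!: linearI
      simp: commutator_def vec_eq_iff matrix_matrix_mult_def algebra_simps sum.distrib
        sum_subtractf scaleR_sum_right)

type_synonym gl2 = "real ^2 ^2"

abbreviation gl2_bracket :: "gl2 \<Rightarrow> gl2 \<Rightarrow> gl2" where
  "gl2_bracket \<equiv> commutator"

interpretation gl2: lie_algebra gl2_bracket
  by unfold_locales
    (rule bilinear_commutator, simp add: commutator_def, rule commutator_jacobi)

typedef u2 = "{A :: complex ^2 ^2. map_matrix cnj (transpose A) = - A}"
  by (rule exI[of _ 0]) (simp add: vec_eq_iff transpose_def)

setup_lifting type_definition_u2

instantiation u2 :: real_vector
begin

lift_definition zero_u2 :: u2 is 0
  by (simp add: vec_eq_iff transpose_def)

lift_definition plus_u2 :: "u2 \<Rightarrow> u2 \<Rightarrow> u2" is "(+)"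
  by (simp add: vec_eq_iff transpose_def)

lift_definition minus_u2 :: "u2 \<Rightarrow> u2 \<Rightarrow> u2" is "(-)"
  by (simp add: vec_eq_iff transpose_def)

lift_definition uminus_u2 :: "u2 \<Rightarrow> u2" is uminus
  by (simp add: vec_eq_iff transpose_def)

lift_definition scaleR_u2 :: "real \<Rightarrow> u2 \<Rightarrow> u2" is scaleR
  by (simp add: vec_eq_iff transpose_def)

instance
  by standard (transfer, simp add: algebra_simps)+

end

lift_definition u2_bracket :: "u2 \<Rightarrow> u2 \<Rightarrow> u2" is commutator
  by (simp add: vec_eq_iff transpose_def commutator_def matrix_matrix_mult_def sum_2)

interpretation u2: lie_algebra u2_bracket
proof
  note b = bilinear_commutator[where 'a = complex and 'n = 2]
  have "u2_bracket (A + B) C = u2_bracket A C + u2_bracket B C"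
    "u2_bracket C (A + B) = u2_bracket C A + u2_bracket C B"
    "u2_bracket (r *\<^sub>R A) C = r *\<^sub>R u2_bracket A C"
    "u2_bracket C (r *\<^sub>R A) = r *\<^sub>R u2_bracket C A" for A B C r
    by (simp_all add: Rep_u2_inject[symmetric] u2_bracket.rep_eq plus_u2.rep_eq scaleR_u2.rep_eq
        bilinear_ladd[OF b] bilinear_radd[OF b] bilinear_lmul[OF b] bilinear_rmul[OF b])
  then show "bilinear u2_bracket"
    by (auto simp: bilinear_def intro!: linearI)
  show "u2_bracket U U = 0" for U
    by transfer (simp add: commutator_def)
  show "u2_bracket U (u2_bracket V W) + u2_bracket V (u2_bracket W U)
      + u2_bracket W (u2_bracket U V) = 0" for U V W
    by transfer (rule commutator_jacobi)
qed

definition basis4 :: "'g::real_vector \<Rightarrow> 'g \<Rightarrow> 'g \<Rightarrow> 'g \<Rightarrow> bool" where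
  "basis4 T X Y Z \<longleftrightarrow>
     distinct [T, X, Y, Z] \<and> independent {T, X, Y, Z} \<and> span {T, X, Y, Z} = UNIV"

definition gl2_basis :: "gl2 \<Rightarrow> gl2 \<Rightarrow> gl2 \<Rightarrow> gl2 \<Rightarrow> bool" where
  "gl2_basis T X Y Z \<longleftrightarrow>
     basis4 T X Y Z \<and> (\<forall>V. gl2_bracket T V = 0) \<and>
     gl2_bracket X Y = Z \<and> gl2_bracket Z X = - Y \<and> gl2_bracket Z Y = X"

definition u2_basis :: "u2 \<Rightarrow> u2 \<Rightarrow> u2 \<Rightarrow> u2 \<Rightarrow> bool" where
  "u2_basis T X Y Z \<longleftrightarrow>
     basis4 T X Y Z \<and> (\<forall>V. u2_bracket T V = 0) \<and>
     u2_bracket X Y = - Z \<and> u2_bracket Z X = - Y \<and> u2_bracket Z Y = X"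

definition dual_form :: "'g::real_vector set \<Rightarrow> 'g \<Rightarrow> 'g \<Rightarrow> real" where
  "dual_form B e V = representation B V e"

lemma basis4I:
  assumes d: "distinct [T, X, Y, Z]"
    and i: "\<And>p q r s. p *\<^sub>R T + q *\<^sub>R X + r *\<^sub>R Y + s *\<^sub>R Z = 0 \<Longrightarrow> p = 0 \<and> q = 0 \<and> r = 0 \<and> s = 0"
    and s: "\<And>V. \<exists>p q r s. V = p *\<^sub>R T + q *\<^sub>R X + r *\<^sub>R Y + s *\<^sub>R Z"
  shows "basis4 T X Y Z"
proof -
  have "independent {T, X, Y, Z}"
  proof
    assume "dependent {T, X, Y, Z}"
    then obtain u where "\<exists>v\<in>{T, X, Y, Z}. u v \<noteq> 0" "(\<Sum>v\<in>{T, X, Y, Z}. u v *\<^sub>R v) = 0"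
      by (auto simp: real_vector.dependent_finite)
    then show False
      using i[of "u T" "u X" "u Y" "u Z"] d by (auto simp: add.assoc)
  qed
  moreover have "V \<in> span {T, X, Y, Z}" for V
  proof -
    obtain p q r s where "V = p *\<^sub>R T + q *\<^sub>R X + r *\<^sub>R Y + s *\<^sub>R Z"
      using s by blast
    moreover have "T \<in> span {T, X, Y, Z}" "X \<in> span {T, X, Y, Z}"
      "Y \<in> span {T, X, Y, Z}" "Z \<in> span {T, X, Y, Z}"
      by (auto intro: span_base)
    ultimately show ?thesis
      by (simp add: span_add span_scale)
  qed
  ultimately show ?thesis
    using d by (auto simp: basis4_def)
qed

lemma gl2_basis_exists: "\<exists>T X Y Z. gl2_basis T X Y Z"
proof -
  define T X Y Z :: gl2 where defs:
    "T = vector [vector [1, 0], vector [0, 1]]"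
    "X = vector [vector [1/2, 0], vector [0, -1/2]]"
    "Y = vector [vector [0, 1/2], vector [1/2, 0]]"
    "Z = vector [vector [0, 1/2], vector [-1/2, 0]]"
  note m = defs vec_eq_iff forall_2 commutator_def matrix_matrix_mult_def sum_2
  have "basis4 T X Y Z"
  proof (rule basis4I)
    fix V :: gl2
    have "V = ((V$1$1 + V$2$2)/2) *\<^sub>R T + (V$1$1 - V$2$2) *\<^sub>R X
        + (V$1$2 + V$2$1) *\<^sub>R Y + (V$1$2 - V$2$1) *\<^sub>R Z"
      by (simp add: m field_simps)
    then show "\<exists>p q r s. V = p *\<^sub>R T + q *\<^sub>R X + r *\<^sub>R Y + s *\<^sub>R Z" by blast
  qed (auto simp: m)
  then show ?thesis
    by (intro exI[of _ T] exI[of _ X] exI[of _ Y] exI[of _ Z])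
      (simp add: gl2_basis_def m)
qed

lemma u2_basis_exists: "\<exists>T X Y Z. u2_basis T X Y Z"
proof -
  define T' X' Y' Z' :: "complex ^2 ^2" where defs:
    "T' = vector [vector [\<i>, 0], vector [0, \<i>]]"
    "X' = vector [vector [0, \<i>/2], vector [\<i>/2, 0]]"
    "Y' = vector [vector [0, 1/2], vector [-1/2, 0]]"
    "Z' = vector [vector [\<i>/2, 0], vector [0, -\<i>/2]]"
  have entries [simp]:
    "T'$1$1 = \<i>" "T'$1$2 = 0" "T'$2$1 = 0" "T'$2$2 = \<i>"
    "X'$1$1 = 0" "X'$1$2 = \<i>/2" "X'$2$1 = \<i>/2" "X'$2$2 = 0"
    "Y'$1$1 = 0" "Y'$1$2 = 1/2" "Y'$2$1 = -1/2" "Y'$2$2 = 0"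
    "Z'$1$1 = \<i>/2" "Z'$1$2 = 0" "Z'$2$1 = 0" "Z'$2$2 = -\<i>/2"
    by (simp_all add: defs)
  have eq_iff: "A = B \<longleftrightarrow> A$1$1 = B$1$1 \<and> A$1$2 = B$1$2 \<and> A$2$1 = B$2$1 \<and> A$2$2 = B$2$2"
    for A B :: "complex ^2 ^2"
    by (auto simp: vec_eq_iff forall_2)
  have comm: "commutator A B $ i $ j =
      A$i$1 * B$1$j + A$i$2 * B$2$j - (B$i$1 * A$1$j + B$i$2 * A$2$j)"
    for A B :: "complex ^2 ^2" and i j
    by (simp add: commutator_def matrix_matrix_mult_def sum_2)
  define T X Y Z where defs': "T = Abs_u2 T'" "X = Abs_u2 X'" "Y = Abs_u2 Y'" "Z = Abs_u2 Z'"
  have skew: "A \<in> {A. map_matrix cnj (transpose A) = - A} \<longleftrightarrow>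
      cnj (A$1$1) = - A$1$1 \<and> cnj (A$2$1) = - A$1$2 \<and> cnj (A$1$2) = - A$2$1 \<and>
      cnj (A$2$2) = - A$2$2" for A :: "complex ^2 ^2"
    by (simp add: eq_iff transpose_def)
  have R: "Rep_u2 T = T'" "Rep_u2 X = X'" "Rep_u2 Y = Y'" "Rep_u2 Z = Z'"
    unfolding defs' by (rule Abs_u2_inverse, unfold skew, simp)+
  note e = Rep_u2_inject[symmetric] plus_u2.rep_eq scaleR_u2.rep_eq zero_u2.rep_eq
    uminus_u2.rep_eq u2_bracket.rep_eq R eq_iff
  have "basis4 T X Y Z"
  proof (rule basis4I)
    fix V :: u2
    let ?V = "Rep_u2 V"
    have "cnj (?V$1$1) = - ?V$1$1" "cnj (?V$2$1) = - ?V$1$2" "cnj (?V$1$2) = - ?V$2$1"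
      "cnj (?V$2$2) = - ?V$2$2"
      using Rep_u2[of V] unfolding skew by auto
    then have "V = (Im (?V$1$1 + ?V$2$2)/2) *\<^sub>R T + (2 * Im (?V$1$2)) *\<^sub>R X
        + (2 * Re (?V$1$2)) *\<^sub>R Y + Im (?V$1$1 - ?V$2$2) *\<^sub>R Z"
      by (simp add: e complex_eq_iff) (simp add: field_simps)
    then show "\<exists>p q r s. V = p *\<^sub>R T + q *\<^sub>R X + r *\<^sub>R Y + s *\<^sub>R Z" by blast
  qed (auto simp: e complex_eq_iff)
  then show ?thesis
    by (intro exI[of _ T] exI[of _ X] exI[of _ Y] exI[of _ Z])
      (auto simp: u2_basis_def e comm complex_eq_iff)
qed

end

theory Submission
  imports Defs
begin

text \<open>
  Both algebras have a central \<open>T\<close> and brackets $[X,Y] = \varepsilon Z$, $[Y,Z] = -X$,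
  $[Z,X] = -Y$, and both complex structures are given by $JX = \varepsilon Y$, $JT = Z$, where
  $\varepsilon = 1$ for $\mathfrak{gl}(2,\mathbb{R})$ and $\varepsilon = -1$ for $\mathfrak{u}(2)$.
  The two parts are therefore proved together, in coordinates with respect to the basis.

  The Nijenhuis tensor of \<open>J\<close> vanishes, and $g = \omega(J\cdot,\cdot)$ is symmetric iff
  $\varepsilon = 1$ or $a = b = 0$; in that case \<open>\<omega>\<close> is \<open>J\<close>-invariant, so it is the fundamental
  form, and $d\omega = d\psi \wedge t = \omega \wedge t$ makes \<open>t\<close> a Lee form. Positivity is a
  completion of squares,
  \[ c\,g(U,U) = (cx + bt + az)^2 + (cy + bz - at)^2 + (c^2 - a^2 - b^2)(t^2 + z^2), \]
  and testing $g$ on $T$ and on the vector $W = cT - bX + aY$ shows that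
  $c > 0$ and $c^2 > a^2 + b^2$ are necessary.

  A closed form vanishes on $[\mathfrak g, \mathfrak g] = \langle X, Y, Z\rangle$, so it is a
  multiple of \<open>t\<close>, and evaluation of $d\omega = \omega \wedge \theta$ on $X, Y, T$ shows that \<open>t\<close> is
  the only Lee form. Its metric dual is proportional to $W$. If \<open>t\<close> is parallel, then $W$ is
  parallel, hence $\mathrm{ad}\,W$ is skew; but $g([W,X],X) = -a^2$ and $g([W,Y],Y) = -b^2$, which
  forces $a = b = 0$. Conversely, for $a = b = 0$ the basis is orthogonal with all vectors of
  squared length \<open>c\<close>, and the Levi-Civita connection has an explicit form with values in
  $\langle X, Y, Z\rangle$, so \<open>t\<close> is parallel.
\<close>

section \<open>The common Lie algebra\<close>

text \<open>
  A Lie algebra with the structure constants above and the parameters \<open>a\<close>, \<open>b\<close>, \<open>c\<close> of the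
  1-form \<open>\<psi>\<close>; the sign \<open>e\<close> is 1 for \<open>gl(2,R)\<close> and \<open>-1\<close> for \<open>u(2)\<close>.
\<close>

locale signed_lie_algebra = lie_algebra br
  for br :: "'g::real_vector \<Rightarrow> 'g \<Rightarrow> 'g" +
  fixes T X Y Z :: 'g and J :: "'g \<Rightarrow> 'g" and e a b c :: real
  assumes basis: "basis4 T X Y Z"
    and sign: "e = 1 \<or> e = -1"
    and central: "br T V = 0"
    and br_XY: "br X Y = e *\<^sub>R Z" and br_ZX: "br Z X = - Y" and br_ZY: "br Z Y = X"
    and linear_J: "linear J"
    and J_T: "J T = Z" and J_Z: "J Z = - T" and J_X: "J X = e *\<^sub>R Y" and J_Y: "J Y = - e *\<^sub>R X"
begin

abbreviation "t \<equiv> dual_form {T, X, Y, Z} T"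
abbreviation "x \<equiv> dual_form {T, X, Y, Z} X"
abbreviation "y \<equiv> dual_form {T, X, Y, Z} Y"
abbreviation "z \<equiv> dual_form {T, X, Y, Z} Z"

text \<open>The vector with prescribed coordinates.\<close>

definition vec4 :: "real \<Rightarrow> real \<Rightarrow> real \<Rightarrow> real \<Rightarrow> 'g" where
  "vec4 p q r s = p *\<^sub>R T + q *\<^sub>R X + r *\<^sub>R Y + s *\<^sub>R Z"

text \<open>The form \<open>\<psi>\<close>, the 2-form $\omega = \psi \wedge t + d\psi$ and the bilinear form
  $\omega(J\cdot,\cdot)$, which is a scalar product only for some values of \<open>a\<close>, \<open>b\<close>, \<open>c\<close>.\<close>

definition psi :: "'g \<Rightarrow> real" where
  "psi = (\<lambda>U. a * x U + b * y U + c * z U)"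

definition omega :: "'g \<Rightarrow> 'g \<Rightarrow> real" where
  "omega = (\<lambda>U V. wedge11 psi t U V + d1 psi U V)"

definition metric :: "'g \<Rightarrow> 'g \<Rightarrow> real" where
  "metric = (\<lambda>U V. omega (J U) V)"

section \<open>Coordinates\<close>

lemma sign_square: "e * e = 1" "e * (e * r) = r"
  using sign by auto

lemma coord_basis [simp]:
  "t T = 1" "t X = 0" "t Y = 0" "t Z = 0"
  "x T = 0" "x X = 1" "x Y = 0" "x Z = 0"
  "y T = 0" "y X = 0" "y Y = 1" "y Z = 0"
  "z T = 0" "z X = 0" "z Y = 0" "z Z = 1"
  using basis by (auto simp: basis4_def dual_form_def real_vector.representation_basis)

lemma linear_coord:
  assumes "E \<in> {T, X, Y, Z}"
  shows "linear (dual_form {T, X, Y, Z} E)"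
  using basis
  by (auto simp: basis4_def dual_form_def real_vector.representation_add
      real_vector.representation_scale intro!: linearI)

lemma coord_linear [simp]:
  assumes "E \<in> {T, X, Y, Z}"
  shows "dual_form {T, X, Y, Z} E (U + V) = dual_form {T, X, Y, Z} E U + dual_form {T, X, Y, Z} E V"
    "dual_form {T, X, Y, Z} E (U - V) = dual_form {T, X, Y, Z} E U - dual_form {T, X, Y, Z} E V"
    "dual_form {T, X, Y, Z} E (- U) = - dual_form {T, X, Y, Z} E U"
    "dual_form {T, X, Y, Z} E (r *\<^sub>R U) = r * dual_form {T, X, Y, Z} E U"
    "dual_form {T, X, Y, Z} E 0 = 0"
  using linear_coord[OF assms]
  by (simp_all add: linear_add linear_diff linear_neg linear_cmul linear_0)

lemma expand: "U = vec4 (t U) (x U) (y U) (z U)"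
proof -
  have "(\<Sum>v\<in>{T, X, Y, Z}. representation {T, X, Y, Z} U v *\<^sub>R v) = U"
    using basis by (intro real_vector.sum_representation_eq) (auto simp: basis4_def)
  then show ?thesis
    using basis by (simp add: basis4_def vec4_def dual_form_def add.assoc)
qed

lemma coord_vec4 [simp]:
  "t (vec4 p q r s) = p" "x (vec4 p q r s) = q" "y (vec4 p q r s) = r" "z (vec4 p q r s) = s"
  by (simp_all add: vec4_def)

lemma coord_eq_iff: "U = V \<longleftrightarrow> t U = t V \<and> x U = x V \<and> y U = y V \<and> z U = z V"
  using expand[of U] expand[of V] by auto

lemma br_antisym: "br U V = - br V U"
proof -
  have "br (U + V) (U + V) = br U U + br U V + (br V U + br V V)"
    by (simp add: bilinear_ladd[OF bilinear_br] bilinear_radd[OF bilinear_br])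
  then have "br U V + br V U = 0"
    by (simp add: br_self)
  then show ?thesis
    by (simp add: eq_neg_iff_add_eq_0)
qed

lemma br_vec4:
  "br (vec4 p q r s) (vec4 p' q' r' s') =
   vec4 0 (s * r' - r * s') (q * s' - s * q') (e * (q * r' - r * q'))"
proof -
  note bl = bilinear_ladd[OF bilinear_br] bilinear_radd[OF bilinear_br]
    bilinear_lmul[OF bilinear_br] bilinear_rmul[OF bilinear_br]
  have b: "br X T = 0" "br Y T = 0" "br Z T = 0" "br Y X = - (e *\<^sub>R Z)" "br X Z = Y" "br Y Z = - X"
    using br_antisym[of X T] br_antisym[of Y T] br_antisym[of Z T] br_antisym[of Y X]
      br_antisym[of X Z] br_antisym[of Y Z]
    by (simp_all add: central br_XY br_ZX br_ZY)
  show ?thesis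
    unfolding vec4_def bl b central br_XY br_ZX br_ZY br_self
    by (simp add: algebra_simps)
qed

lemma coord_br [simp]:
  "t (br U V) = 0"
  "x (br U V) = z U * y V - y U * z V"
  "y (br U V) = x U * z V - z U * x V"
  "z (br U V) = e * (x U * y V - y U * x V)"
  by (subst expand[of U], subst expand[of V], simp add: br_vec4)+

lemma coord_J [simp]:
  "t (J U) = - z U" "x (J U) = - e * y U" "y (J U) = e * x U" "z (J U) = t U"
  by (subst expand[of U],
      simp add: vec4_def linear_add[OF linear_J] linear_cmul[OF linear_J] J_T J_X J_Y J_Z)+

lemma omega_eq:
  "omega U V = psi U * t V - psi V * t U + a * (y U * z V - z U * y V)
     + b * (z U * x V - x U * z V) - e * c * (x U * y V - y U * x V)"
  by (simp add: omega_def wedge11_def d1_def psi_def algebra_simps)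

lemma metric_eq:
  "metric U V = (e * (b * x U - a * y U) + c * t U) * t V + z U * psi V
     + a * (e * x U * z V - t U * y V) + b * (t U * x V + e * y U * z V)
     + c * (x U * x V + y U * y V)"
  by (simp add: metric_def omega_eq psi_def algebra_simps sign_square)

section \<open>The Hermitian structure and its Lee form\<close>

lemma nijenhuis_J: "nijenhuis J U V = 0"
  using sign by (auto simp: coord_eq_iff nijenhuis_def algebra_simps)

lemma J_square: "J (J U) = - U"
  by (simp add: coord_eq_iff sign_square)

text \<open>In the compact case, symmetry of the bilinear form alone forces \<open>\<psi>\<close> to be a multiple
  of \<open>z\<close>.\<close>

lemma metric_symmetric_iff:
  "(\<forall>U V. metric U V = metric V U) \<longleftrightarrow> e = 1 \<or> a = 0 \<and> b = 0"
proof
  assume "\<forall>U V. metric U V = metric V U"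
  then have "metric X T = metric T X" "metric Y T = metric T Y"
    by blast+
  then show "e = 1 \<or> a = 0 \<and> b = 0"
    using sign by (auto simp: metric_eq psi_def)
qed (auto simp: metric_eq psi_def algebra_simps)

text \<open>The metric dual of \<open>t\<close>, up to the factor $c^2 - a^2 - b^2$, when the bilinear form is a
  scalar product.\<close>

definition lee_vector :: 'g where
  "lee_vector = vec4 c (- b) a 0"

lemma metric_lee_vector:
  assumes "e = 1 \<or> a = 0 \<and> b = 0"
  shows "metric lee_vector V = (c\<^sup>2 - (a\<^sup>2 + b\<^sup>2)) * t V"
  using assms by (auto simp: lee_vector_def metric_eq psi_def algebra_simps power2_eq_square)

lemma metric_pos:
  assumes e: "e = 1 \<or> a = 0 \<and> b = 0" and c: "c > 0" "a\<^sup>2 + b\<^sup>2 < c\<^sup>2" and U: "U \<noteq> 0"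
  shows "0 < metric U U"
proof -
  let ?p = "c * x U + b * t U + a * z U" and ?q = "c * y U + b * z U - a * t U"
  have sq: "c * metric U U = ?p\<^sup>2 + ?q\<^sup>2 + (c\<^sup>2 - (a\<^sup>2 + b\<^sup>2)) * ((t U)\<^sup>2 + (z U)\<^sup>2)"
    using e by (auto simp: metric_eq psi_def algebra_simps power2_eq_square)
  have "0 < c * metric U U"
  proof (cases "t U = 0 \<and> z U = 0")
    case True
    then have "x U \<noteq> 0 \<or> y U \<noteq> 0"
      using U by (auto simp: coord_eq_iff)
    with c True show ?thesis
      unfolding sq by (simp add: sum_power2_gt_zero_iff)
  next
    case False
    then have "0 < (c\<^sup>2 - (a\<^sup>2 + b\<^sup>2)) * ((t U)\<^sup>2 + (z U)\<^sup>2)"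
      using c by (intro mult_pos_pos) (auto simp: sum_power2_gt_zero_iff)
    then show ?thesis
      unfolding sq by (intro add_nonneg_pos) auto
  qed
  with c show ?thesis
    by (simp add: zero_less_mult_iff)
qed

lemma scalar_product_metric_iff:
  "scalar_product metric \<longleftrightarrow> (e = 1 \<or> a = 0 \<and> b = 0) \<and> c > 0 \<and> a\<^sup>2 + b\<^sup>2 < c\<^sup>2"
proof
  assume sp: "scalar_product metric"
  then have e: "e = 1 \<or> a = 0 \<and> b = 0"
    using metric_symmetric_iff by (auto simp: scalar_product_def)
  have pos: "0 < metric U U" if "U \<noteq> 0" for U
    using sp that by (simp add: scalar_product_def)
  have "0 < metric T T"
    by (rule pos) (simp add: coord_eq_iff)
  then have c: "c > 0"
    by (simp add: metric_eq psi_def)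
  then have "0 < metric lee_vector lee_vector"
    by (intro pos) (simp add: coord_eq_iff lee_vector_def)
  then have "0 < (c\<^sup>2 - (a\<^sup>2 + b\<^sup>2)) * c"
    unfolding metric_lee_vector[OF e] by (simp add: lee_vector_def)
  with e c show "(e = 1 \<or> a = 0 \<and> b = 0) \<and> c > 0 \<and> a\<^sup>2 + b\<^sup>2 < c\<^sup>2"
    by (simp add: zero_less_mult_iff)
next
  assume h: "(e = 1 \<or> a = 0 \<and> b = 0) \<and> c > 0 \<and> a\<^sup>2 + b\<^sup>2 < c\<^sup>2"
  then have "\<forall>U V. metric U V = metric V U"
    using metric_symmetric_iff by simp
  moreover have "bilinear metric"
    unfolding bilinear_def by (auto intro!: linearI simp: metric_eq psi_def algebra_simps)
  ultimately show "scalar_product metric"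
    unfolding scalar_product_def using metric_pos h by simp
qed

lemma fundamental_form_metric:
  assumes "e = 1 \<or> a = 0 \<and> b = 0"
  shows "fundamental_form metric J U V = omega U V"
  using assms
  by (auto simp: fundamental_form_def metric_eq omega_eq psi_def algebra_simps sign_square)

lemma hermitian_metric_iff:
  "hermitian metric J \<longleftrightarrow> (e = 1 \<or> a = 0 \<and> b = 0) \<and> c > 0 \<and> a\<^sup>2 + b\<^sup>2 < c\<^sup>2"
proof -
  have "metric (J U) V = - metric U (J V)" if "e = 1 \<or> a = 0 \<and> b = 0" for U V
  proof -
    have "omega (- U) V = - omega U V"
      by (simp add: omega_eq psi_def algebra_simps)
    then show ?thesis
      using fundamental_form_metric[OF that, of U V]
      by (simp add: fundamental_form_def metric_def J_square)
  qed
  then show ?thesis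
    using scalar_product_metric_iff linear_J J_square nijenhuis_J
    unfolding hermitian_def by blast
qed

lemma lee_form_t:
  assumes "e = 1 \<or> a = 0 \<and> b = 0"
  shows "lee_form metric J t"
proof -
  have "fundamental_form metric J = omega"
    using fundamental_form_metric[OF assms] by blast
  then show ?thesis
    using sign
    by (auto simp: lee_form_def linear_coord d1_def d2_def wedge21_def omega_eq psi_def algebra_simps)
qed

lemma lee_form_unique:
  assumes lee: "lee_form metric J \<theta>" and e: "e = 1 \<or> a = 0 \<and> b = 0" and c: "c \<noteq> 0"
  shows "\<theta> = t"
proof
  fix U
  have lin: "linear \<theta>" and closed: "\<theta> (br V W) = 0" for V W
    using lee by (auto simp: lee_form_def d1_def)
  have "\<theta> X = 0" "\<theta> Y = 0" "\<theta> Z = 0"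
    using closed[of Z Y] closed[of Z X] closed[of X Y] sign
    by (auto simp: br_XY br_ZX br_ZY linear_neg[OF lin] linear_cmul[OF lin])
  moreover have "\<theta> T = 1"
  proof -
    have "d2 (fundamental_form metric J) X Y T = wedge21 (fundamental_form metric J) \<theta> X Y T"
      using lee by (simp add: lee_form_def)
    then show ?thesis
      using \<open>\<theta> X = 0\<close> \<open>\<theta> Y = 0\<close> c sign
      by (auto simp: d2_def wedge21_def fundamental_form_metric[OF e] omega_eq psi_def)
  qed
  ultimately show "\<theta> U = t U"
    by (subst expand[of U]) (simp add: vec4_def linear_add[OF lin] linear_cmul[OF lin])
qed

lemma lcK_metric_iff:
  "lcK metric J \<longleftrightarrow> (e = 1 \<or> a = 0 \<and> b = 0) \<and> c > 0 \<and> a\<^sup>2 + b\<^sup>2 < c\<^sup>2"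
  using hermitian_metric_iff lee_form_t unfolding lcK_def by blast

section \<open>The Vaisman condition\<close>

text \<open>If \<open>t\<close> is parallel, then so is its metric dual, and torsion-freeness makes \<open>ad\<close> of it
  skew-symmetric.\<close>

lemma metric_br_lee_vector:
  assumes e: "e = 1 \<or> a = 0 \<and> b = 0" and lc: "levi_civita metric nabla"
    and parallel: "\<And>U V. t (nabla U V) = 0"
  shows "metric U (br lee_vector U) = 0"
proof -
  have sym: "metric V W = metric W V" for V W
    using e metric_symmetric_iff by blast
  have compat: "metric (nabla V W) W' + metric W (nabla V W') = 0" for V W W'
    using lc by (simp add: levi_civita_def)
  have tors: "br lee_vector U = nabla lee_vector U - nabla U lee_vector"
    using lc by (simp add: levi_civita_def)
  have "metric U (nabla U lee_vector) = 0"
    using compat[of U lee_vector U] sym[of U "nabla U lee_vector"]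
    by (simp add: metric_lee_vector[OF e] parallel)
  moreover have "metric U (nabla lee_vector U) = 0"
    using compat[of lee_vector U U] sym[of U "nabla lee_vector U"] by simp
  moreover have "metric U (V - W) = metric U V - metric U W" for V W
    by (simp add: metric_eq psi_def algebra_simps)
  ultimately show ?thesis
    by (simp add: tors)
qed

text \<open>The Levi-Civita connection for $a = b = 0$; the coefficients come from the Koszul formula
  in the orthogonal basis \<open>T, X, Y, Z\<close>.\<close>

definition connection :: "'g \<Rightarrow> 'g \<Rightarrow> 'g" where
  "connection U V = vec4 0
     (e / 2 * y U * z V + (1 + e / 2) * z U * y V)
     (- (1 + e / 2) * z U * x V - e / 2 * x U * z V)
     (e / 2 * x U * y V - e / 2 * y U * x V)"

lemma levi_civita_connection:
  assumes "a = 0" "b = 0"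
  shows "levi_civita metric connection"
proof -
  have "bilinear connection"
    unfolding bilinear_def
    by (auto intro!: linearI simp: coord_eq_iff connection_def algebra_simps add_divide_distrib)
  moreover have "connection U V - connection V U = br U V" for U V
    by (simp add: coord_eq_iff connection_def field_simps)
  moreover have "metric U V = c * (t U * t V + x U * x V + y U * y V + z U * z V)" for U V
    unfolding metric_eq psi_def using assms by (simp add: algebra_simps)
  then have "metric (connection U V) W + metric V (connection U W) = 0" for U V W
    by (simp add: connection_def field_simps)
  ultimately show ?thesis
    by (simp add: levi_civita_def)
qed

lemma vaisman_metric_iff: "vaisman metric J \<longleftrightarrow> c > 0 \<and> a = 0 \<and> b = 0"
proof
  assume v: "vaisman metric J"
  then have e: "e = 1 \<or> a = 0 \<and> b = 0" and c: "c > 0"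
    using hermitian_metric_iff by (auto simp: vaisman_def)
  obtain \<theta> nabla where lee: "lee_form metric J \<theta>" and lc: "levi_civita metric nabla"
    and parallel: "\<And>U V. \<theta> (nabla U V) = 0"
    using v by (auto simp: vaisman_def covariant_derivative_def)
  have "\<theta> = t"
    using lee_form_unique[OF lee e] c by simp
  then have "metric U (br lee_vector U) = 0" for U
    using metric_br_lee_vector[OF e lc] parallel by blast
  from this[of X] this[of Y] e show "c > 0 \<and> a = 0 \<and> b = 0"
    using c by (auto simp: metric_eq psi_def lee_vector_def)
next
  assume "c > 0 \<and> a = 0 \<and> b = 0"
  then show "vaisman metric J"
    using hermitian_metric_iff lee_form_t levi_civita_connection
    unfolding vaisman_def covariant_derivative_def
    by (intro conjI exI[of _ t] exI[of _ connection]) (auto simp: connection_def)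
qed

end

section \<open>The two Lie algebras\<close>

theorem proposition3:
  fixes a b c :: real
    and T1 X1 Y1 Z1 :: gl2 and J1 :: "gl2 \<Rightarrow> gl2"
    and T2 X2 Y2 Z2 :: u2 and J2 :: "u2 \<Rightarrow> u2"
  assumes basis1: "gl2_basis T1 X1 Y1 Z1"
    and J1: "linear J1" "J1 X1 = Y1" "J1 Y1 = - X1" "J1 T1 = Z1" "J1 Z1 = - T1"
    and basis2: "u2_basis T2 X2 Y2 Z2"
    and J2: "linear J2" "J2 Y2 = X2" "J2 X2 = - Y2" "J2 T2 = Z2" "J2 Z2 = - T2"
  shows
    "(let B = {T1, X1, Y1, Z1};
          t = dual_form B T1; x = dual_form B X1; y = dual_form B Y1; z = dual_form B Z1;
          \<psi> = (\<lambda>U. a * x U + b * y U + c * z U);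
          \<omega> = (\<lambda>U V. wedge11 \<psi> t U V + gl2.d1 \<psi> U V);
          g = (\<lambda>U V. \<omega> (J1 U) V)
      in (gl2.lcK g J1 \<longleftrightarrow> c > 0 \<and> c\<^sup>2 > a\<^sup>2 + b\<^sup>2) \<and>
         (gl2.vaisman g J1 \<longleftrightarrow> c > 0 \<and> a = 0 \<and> b = 0) \<and>
         (gl2.lcK g J1 \<and> \<not> gl2.vaisman g J1 \<longleftrightarrow>
            c > 0 \<and> c\<^sup>2 > a\<^sup>2 + b\<^sup>2 \<and> a\<^sup>2 + b\<^sup>2 > 0))
     \<and>
     (let B = {T2, X2, Y2, Z2};
          t = dual_form B T2; x = dual_form B X2; y = dual_form B Y2; z = dual_form B Z2;
          \<psi> = (\<lambda>U. a * x U + b * y U + c * z U);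
          \<omega> = (\<lambda>U V. wedge11 \<psi> t U V + u2.d1 \<psi> U V);
          g = (\<lambda>U V. \<omega> (J2 U) V)
      in (u2.lcK g J2 \<longleftrightarrow> c > 0 \<and> a = 0 \<and> b = 0) \<and>
         (u2.lcK g J2 \<longrightarrow> u2.vaisman g J2))"
proof -
  interpret L1: signed_lie_algebra gl2_bracket T1 X1 Y1 Z1 J1 1 a b c
    by (intro signed_lie_algebra.intro signed_lie_algebra_axioms.intro gl2.lie_algebra_axioms)
      (use basis1 J1 in \<open>auto simp: gl2_basis_def\<close>)
  interpret L2: signed_lie_algebra u2_bracket T2 X2 Y2 Z2 J2 "-1" a b c
    by (intro signed_lie_algebra.intro signed_lie_algebra_axioms.intro u2.lie_algebra_axioms)
      (use basis2 J2 in \<open>auto simp: u2_basis_def\<close>)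
  have sq: "0 < a\<^sup>2 + b\<^sup>2 \<longleftrightarrow> \<not> (a = 0 \<and> b = 0)"
    by (simp add: sum_power2_gt_zero_iff)
  have m1: "L1.metric = (\<lambda>U V. wedge11 L1.psi L1.t (J1 U) V + gl2.d1 L1.psi (J1 U) V)"
    by (simp only: L1.metric_def L1.omega_def)
  have m2: "L2.metric = (\<lambda>U V. wedge11 L2.psi L2.t (J2 U) V + u2.d1 L2.psi (J2 U) V)"
    by (simp only: L2.metric_def L2.omega_def)
  show ?thesis
    unfolding Let_def
    unfolding L1.psi_def[symmetric] L2.psi_def[symmetric]
    unfolding m1[symmetric] m2[symmetric]
    unfolding L1.lcK_metric_iff L1.vaisman_metric_iff L2.lcK_metric_iff L2.vaisman_metric_iff sq
    by auto
qed

end
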